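(* Let $M^4$ be a closed, smooth, orientable 4-manifold, and let $M^4 = X_1 \cup X_2 \cup X_3$ and $M^4 = X_1' \cup X_2' \cup X_3'$ be two $(g,k)$-trisections of $M^4$. If these trisections are isotopic, then $\mathscr{N}(X_i) = \mathscr{N}(X_i')$ for each $i\in\{1,2,3\}$. If the trisections are diffeomorphic by some diffeomorphism $f$, then $f(\mathscr{N}(X_i)) = \mathscr{N}(X_i')$ for each $i\in\{1,2,3\}$.
   Context: **Handlebodies and spines.** For $n\ge 3$, $H_g^n$ denotes the $n$-dimensional handlebody of genus $g$: the smooth orientable manifold obtained by attaching $g$ 1-handles to an $n$-ball. A spine of $H_g^n$ is an embedded graph that is a deformation retract of it; spines are assumed to have a single vertex and oriented edges, so a spine is a wedge of $g$ oriented circles. **Trisections.** A $(g,k)$-trisection of a closed smooth orientable 4-manifold $M$ is a decomposition $M=X_1\cup X_2\cup X_3$ with $X_i\cong H_k^4$; $X_i\cap X_j=H_{ij}\cong H_g^3$ for $i\ne j$; and, for $\{i,j,l\}=\{1,2,3\}$, $\partial X_i=H_{ij}\cup H_{il}$ a genus $g$ Heegaard splitting of $\partial X_i\cong\#^k S^1\times S^2$. Trisections $X_1\cup X_2\cup X_3$ and $X_1'\cup X_2'\cup X_3'$ of $M$ are diffeomorphic (by $f$) if $f:M\to M$ is a diffeomorphism with $f(X_i)=X_i'$ for all $i$, and isotopic if there is an isotopy $f_t$ of $M$ with $f_0=\mathrm{id}$ and $f_1(X_i)=X_i'$ for all $i$. For a trisection, the inclusion of each $X_i$ in $M$ is surjective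 on $\pi_1$. **Nielsen classes.** Two generating $n$-tuples $(a_1,\dots,a_n)$, $(b_1,\dots,b_n)$ of a group $G$ are Nielsen equivalent if there are a basis $(y_1,\dots,y_n)$ of the free group $F_n=F[x_1,\dots,x_n]$ and a homomorphism $\phi:F_n\to G$ with $\phi(x_i)=a_i$ and $\phi(y_i)=b_i$ for all $i$. If $H\subset M$ is an embedded $n$-dimensional genus $g$ handlebody in an $n$-manifold whose inclusion is surjective on $\pi_1$, then $\mathscr{N}(H)$ denotes the Nielsen equivalence class of the generating $g$-tuple of $\pi_1(M)$ given by the loops of a spine of $H$ (independent of the spine and of base-path choices, since simultaneous conjugation of a generating tuple is a Nielsen equivalence). For a self-homeomorphism $f$ of $M$, $f(\mathscr{N}(H))$ is the Nielsen class obtained by applying the induced map on fundamental groups to each loop of some spine of $H$. *)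

theory Defs
  imports "HOL-Analysis.Analysis" "HOL-Algebra.Generated_Groups"
begin

section \<open>Smooth maps between subsets of smooth manifolds\<close>

primrec Ck_on :: "nat \<Rightarrow> 'e::real_normed_vector set \<Rightarrow> ('e \<Rightarrow> 'f::real_normed_vector) \<Rightarrow> bool" where
  "Ck_on 0 S f \<longleftrightarrow> continuous_on S f"
| "Ck_on (Suc k) S f \<longleftrightarrow>
     (\<forall>x\<in>S. f differentiable (at x)) \<and> (\<forall>v. Ck_on k S (\<lambda>x. frechet_derivative f (at x) v))"

text \<open>To be used for open \<open>S\<close> only.\<close>

definition smooth_on :: "'e::real_normed_vector set \<Rightarrow> ('e \<Rightarrow> 'f::real_normed_vector) \<Rightarrow> bool" where
  "smooth_on S f \<longleftrightarrow> (\<forall>k. Ck_on k S f)"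

text \<open>A chart is a pair of its domain and its coordinate map.\<close>

type_synonym ('a, 'e) atlas = "('a set \<times> ('a \<Rightarrow> 'e)) set"

definition smooth_atlas :: "'a::topological_space set \<Rightarrow> ('a, 'e::euclidean_space) atlas \<Rightarrow> bool" where
  "smooth_atlas M A \<longleftrightarrow>
     (\<Union>(U, \<phi>)\<in>A. U) = M \<and>
     (\<forall>(U, \<phi>)\<in>A. openin (top_of_set M) U \<and> open (\<phi> ` U) \<and>
                 homeomorphism U (\<phi> ` U) \<phi> (inv_into U \<phi>)) \<and>
     (\<forall>(U, \<phi>)\<in>A. \<forall>(V, \<psi>)\<in>A. smooth_on (\<phi> ` (U \<inter> V)) (\<psi> \<circ> inv_into U \<phi>))"

text \<open>Second countability is not listed because it follows from compactness.\<close>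

definition closed_smooth_manifold ::
  "'a::topological_space set \<Rightarrow> ('a, 'e::euclidean_space) atlas \<Rightarrow> bool" where
  "closed_smooth_manifold M A \<longleftrightarrow>
     smooth_atlas M A \<and> compact M \<and> Hausdorff_space (top_of_set M)"

definition orientable_atlas :: "'a::topological_space set \<Rightarrow> ('a, real ^ 'n) atlas \<Rightarrow> bool" where
  "orientable_atlas M A \<longleftrightarrow>
     (\<exists>B. smooth_atlas M B \<and> smooth_atlas M (A \<union> B) \<and>
        (\<forall>(U, \<phi>)\<in>B. \<forall>(V, \<psi>)\<in>B. \<forall>x\<in>\<phi> ` (U \<inter> V).
           det (matrix (frechet_derivative (\<psi> \<circ> inv_into U \<phi>) (at x))) > 0))"

definition euclidean_atlas :: "('e::euclidean_space, 'e) atlas" where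
  "euclidean_atlas = {(UNIV, \<lambda>x. x)}"

definition product_line_atlas :: "('a, 'e) atlas \<Rightarrow> ('a \<times> real, 'e \<times> real) atlas" where
  "product_line_atlas A = (\<lambda>(U, \<phi>). (U \<times> UNIV, \<lambda>(x, t). (\<phi> x, t))) ` A"

text \<open>
  The sets \<open>X\<close> below are arbitrary subsets of manifolds with atlases \<open>A\<close> and \<open>B\<close>; as usual, a map on
  a set that need not be open is smooth if in charts it extends locally to a smooth map on an open
  set.  This covers submanifolds with boundary and corners of any codimension, with their
  induced smooth structures; a diffeomorphism in this sense preserves corners.
\<close>

definition smooth_map ::
  "('a::topological_space, 'e::euclidean_space) atlas \<Rightarrow> 'a set \<Rightarrow>
   ('b::topological_space, 'f::euclidean_space) atlas \<Rightarrow> ('a \<Rightarrow> 'b) \<Rightarrow> bool" where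
  "smooth_map A X B f \<longleftrightarrow>
     continuous_on X f \<and>
     (\<forall>p\<in>X. \<forall>(U, \<phi>)\<in>A. \<forall>(V, \<psi>)\<in>B. p \<in> U \<and> f p \<in> V \<longrightarrow>
        (\<exists>W h. open W \<and> \<phi> p \<in> W \<and> smooth_on W h \<and>
           (\<forall>x\<in>X \<inter> U. \<phi> x \<in> W \<and> f x \<in> V \<longrightarrow> h (\<phi> x) = \<psi> (f x))))"

definition diffeomorphism ::
  "('a::topological_space, 'e::euclidean_space) atlas \<Rightarrow> 'a set \<Rightarrow>
   ('b::topological_space, 'f::euclidean_space) atlas \<Rightarrow> 'b set \<Rightarrow> ('a \<Rightarrow> 'b) \<Rightarrow> bool" where
  "diffeomorphism A X B Y f \<longleftrightarrow>
     bij_betw f X Y \<and> smooth_map A X B f \<and> smooth_map B Y A (inv_into X f)"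

text \<open>
  The boundary of a topological \<open>n\<close>-manifold with boundary \<open>X\<close>: the points without a
  neighbourhood in \<open>X\<close> homeomorphic to an open subset of Euclidean \<open>n\<close>-space.
\<close>

definition manifold_boundary :: "nat \<Rightarrow> 'a::topological_space set \<Rightarrow> 'a set" where
  "manifold_boundary n X =
     {p\<in>X. \<not> (\<exists>U V. openin (top_of_set X) U \<and> p \<in> U \<and> openin (Euclidean_space n) V \<and>
                top_of_set U homeomorphic_space subtopology (Euclidean_space n) V)}"


section \<open>Handlebodies\<close>

text \<open>
  The type \<open>real \<times> real \<times> 'c\<close> plays the role of Euclidean space of dimension
  \<open>n = DIM('c) + 2\<close>.  The set \<open>sector \<alpha>\<close> (for \<open>0 < \<alpha> < 2\<pi>\<close>) is the local model of a corner of angle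
  \<open>\<alpha>\<close> along a codimension 2 edge, \<open>sector pi\<close> being a half-space; corners are straightened by
  \<open>(r, \<theta>, y) \<mapsto> (r, \<pi>\<theta>/\<alpha>, y)\<close> in polar coordinates.
\<close>

definition sector :: "real \<Rightarrow> (real \<times> real \<times> 'c) set" where
  "sector \<alpha> = {(s, t, y). Arg2pi (Complex s t) \<le> \<alpha>}"

definition straighten :: "real \<Rightarrow> real \<times> real \<times> 'c \<Rightarrow> real \<times> real \<times> 'c" where
  "straighten \<alpha> = (\<lambda>(s, t, y).
     let r = cmod (Complex s t); \<theta> = Arg2pi (Complex s t)
     in (r * cos (pi * \<theta> / \<alpha>), r * sin (pi * \<theta> / \<alpha>), y))"

text \<open>
  \<open>X\<close> is an \<open>n\<close>-dimensional submanifold with boundary whose corners all lie in \<open>C\<close>,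
  \<open>Z\<close> is a smooth domain with boundary (without corners) in Euclidean \<open>n\<close>-space, and \<open>F\<close> identifies
  \<open>Z\<close> with the result of straightening the corners of \<open>X\<close>.
  For points outside \<open>C\<close> we have \<open>\<alpha> = \<pi>\<close> and the condition says that \<open>F\<close> is a local diffeomorphism.
\<close>

definition corner_straightening ::
  "('a::topological_space, 'e::euclidean_space) atlas \<Rightarrow> 'a set \<Rightarrow> 'a set \<Rightarrow>
   (real \<times> real \<times> 'c::euclidean_space) set \<Rightarrow> ('a \<Rightarrow> real \<times> real \<times> 'c) \<Rightarrow> bool" where
  "corner_straightening A X C Z F \<longleftrightarrow>
     homeomorphism X Z F (inv_into X F) \<and>
     (\<forall>p\<in>X. \<exists>\<alpha> U \<phi> \<psi>.
        0 < \<alpha> \<and> \<alpha> < 2 * pi \<and> (\<alpha> = pi \<or> p \<in> C) \<and>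
        openin (top_of_set X) U \<and> p \<in> U \<and>
        openin (top_of_set (sector \<alpha>)) (\<phi> ` U) \<and>
        diffeomorphism A U euclidean_atlas (\<phi> ` U :: (real \<times> real \<times> 'c) set) \<phi> \<and>
        openin (top_of_set (sector pi)) (\<psi> ` F ` U) \<and>
        diffeomorphism euclidean_atlas (F ` U) euclidean_atlas
          (\<psi> ` F ` U :: (real \<times> real \<times> 'c) set) \<psi> \<and>
        (\<forall>x\<in>U. \<psi> (F x) = straighten \<alpha> (\<phi> x)))"

text \<open>
  The unit \<open>n\<close>-ball with \<open>g\<close> disjoint 1-handles \<open>D\<^sup>1 \<times> D\<^sup>n\<^sup>-\<^sup>1\<close> attached along
  \<open>\<partial>D\<^sup>1 \<times> D\<^sup>n\<^sup>-\<^sup>1\<close>.  The construction is carried out inside Euclidean \<open>n\<close>-space, which ensures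
  orientability; for \<open>n \<ge> 3\<close> every orientable handlebody arises in this way.
\<close>

definition ball_with_one_handles :: "nat \<Rightarrow> (real \<times> real \<times> 'c::euclidean_space) set \<Rightarrow> bool" where
  "ball_with_one_handles g Y \<longleftrightarrow>
     (\<exists>h :: nat \<Rightarrow> real \<times> real \<times> 'c \<Rightarrow> real \<times> real \<times> 'c.
        let D = {-1..1} \<times> cball 0 1; E = {-1, 1} \<times> cball 0 1 in
        (\<forall>j<g. diffeomorphism euclidean_atlas D euclidean_atlas (h j ` D) (h j) \<and>
               h j ` D \<inter> cball 0 1 = h j ` E \<and> h j ` E \<subseteq> sphere 0 1) \<and>
        (\<forall>i<g. \<forall>j<g. i \<noteq> j \<longrightarrow> h i ` D \<inter> h j ` D = {}) \<and>
        Y = cball 0 1 \<union> (\<Union>j<g. h j ` D))"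

text \<open>The smooth handlebody of genus \<open>g\<close>, realised in Euclidean \<open>n\<close>-space for \<open>n = DIM('c) + 2\<close>.\<close>

definition smooth_handlebody :: "nat \<Rightarrow> (real \<times> real \<times> 'c::euclidean_space) set \<Rightarrow> bool" where
  "smooth_handlebody g Z \<longleftrightarrow>
     (\<exists>(Y :: (real \<times> real \<times> 'c) set) F.
        ball_with_one_handles g Y \<and> corner_straightening euclidean_atlas Y Y Z F)"

definition handlebody3 :: "('a::topological_space, 'e::euclidean_space) atlas \<Rightarrow> nat \<Rightarrow> 'a set \<Rightarrow> bool" where
  "handlebody3 A g H \<longleftrightarrow>
     (\<exists>(Z :: (real \<times> real \<times> real) set) F.
        smooth_handlebody g Z \<and> diffeomorphism A H euclidean_atlas Z F)"

text \<open>\<open>H\<close> may have corners along \<open>C\<close>.\<close>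

definition handlebody4 ::
  "('a::topological_space, 'e::euclidean_space) atlas \<Rightarrow> 'a set \<Rightarrow> nat \<Rightarrow> 'a set \<Rightarrow> bool" where
  "handlebody4 A C k H \<longleftrightarrow>
     (\<exists>(Z :: (real \<times> real \<times> real \<times> real) set) F.
        smooth_handlebody k Z \<and> corner_straightening A H C Z F)"


section \<open>Trisections\<close>

definition heegaard_splitting ::
  "('a::topological_space, 'e::euclidean_space) atlas \<Rightarrow> nat \<Rightarrow> 'a set \<Rightarrow> 'a set \<Rightarrow> 'a set \<Rightarrow> bool" where
  "heegaard_splitting A g N V W \<longleftrightarrow>
     N = V \<union> W \<and> handlebody3 A g V \<and> handlebody3 A g W \<and>
     V \<inter> W = manifold_boundary 3 V \<and> V \<inter> W = manifold_boundary 3 W"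

text \<open>
  The pieces \<open>X i\<close> necessarily have corners along the central surface \<open>X 1 \<inter> X 2 \<inter> X 3\<close>, so the
  diffeomorphism of \<open>X i\<close> with the 4-dimensional handlebody is to be understood after straightening
  them.  That the boundary of \<open>X i\<close> is a connected sum of \<open>k\<close> copies of \<open>S\<^sup>1 \<times> S\<^sup>2\<close> is then automatic:
  that manifold is the boundary of the handlebody of genus \<open>k\<close>.
\<close>

definition trisection ::
  "'a::topological_space set \<Rightarrow> ('a, 'e::euclidean_space) atlas \<Rightarrow> nat \<Rightarrow> nat \<Rightarrow> (nat \<Rightarrow> 'a set) \<Rightarrow> bool" where
  "trisection M A g k X \<longleftrightarrow>
     M = X 1 \<union> X 2 \<union> X 3 \<and>
     (\<forall>i\<in>{1, 2, 3}. handlebody4 A (X 1 \<inter> X 2 \<inter> X 3) k (X i)) \<and>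
     (\<forall>i\<in>{1, 2, 3}. \<forall>j\<in>{1, 2, 3}. i \<noteq> j \<longrightarrow> handlebody3 A g (X i \<inter> X j)) \<and>
     (\<forall>i j l. {i, j, l} = {1, 2, 3} \<longrightarrow>
        heegaard_splitting A g (manifold_boundary 4 (X i)) (X i \<inter> X j) (X i \<inter> X l))"

definition diffeomorphic_trisections ::
  "'a::topological_space set \<Rightarrow> ('a, 'e::euclidean_space) atlas \<Rightarrow>
   (nat \<Rightarrow> 'a set) \<Rightarrow> (nat \<Rightarrow> 'a set) \<Rightarrow> ('a \<Rightarrow> 'a) \<Rightarrow> bool" where
  "diffeomorphic_trisections M A X X' f \<longleftrightarrow>
     diffeomorphism A M A M f \<and> (\<forall>i\<in>{1, 2, 3}. f ` X i = X' i)"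

definition smooth_isotopy ::
  "'a::topological_space set \<Rightarrow> ('a, 'e::euclidean_space) atlas \<Rightarrow> (real \<Rightarrow> 'a \<Rightarrow> 'a) \<Rightarrow> bool" where
  "smooth_isotopy M A f \<longleftrightarrow>
     smooth_map (product_line_atlas A) (M \<times> {0..1}) A (\<lambda>(x, t). f t x) \<and>
     (\<forall>t\<in>{0..1}. diffeomorphism A M A M (f t))"

definition isotopic_trisections ::
  "'a::topological_space set \<Rightarrow> ('a, 'e::euclidean_space) atlas \<Rightarrow>
   (nat \<Rightarrow> 'a set) \<Rightarrow> (nat \<Rightarrow> 'a set) \<Rightarrow> bool" where
  "isotopic_trisections M A X X' \<longleftrightarrow>
     (\<exists>f. smooth_isotopy M A f \<and> (\<forall>x\<in>M. f 0 x = x) \<and> (\<forall>i\<in>{1, 2, 3}. f 1 ` X i = X' i))"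


section \<open>Fundamental groups\<close>

definition path_class :: "'a::topological_space set \<Rightarrow> (real \<Rightarrow> 'a) \<Rightarrow> (real \<Rightarrow> 'a) set" where
  "path_class M \<gamma> = {\<delta>. homotopic_paths M \<gamma> \<delta>}"

definition fundamental_group :: "'a::topological_space set \<Rightarrow> 'a \<Rightarrow> (real \<Rightarrow> 'a) set monoid" where
  "fundamental_group M p =
     \<lparr>carrier = {path_class M \<gamma> | \<gamma>. path \<gamma> \<and> path_image \<gamma> \<subseteq> M \<and> pathstart \<gamma> = p \<and> pathfinish \<gamma> = p},
      mult = (\<lambda>a b. \<Union>\<gamma>\<in>a. \<Union>\<delta>\<in>b. path_class M (\<gamma> +++ \<delta>)),
      one = path_class M (\<lambda>_. p)\<rparr>"

text \<open>For \<open>f : M \<rightarrow> M\<close>, the map from \<open>fundamental_group M p\<close> to \<open>fundamental_group M (f p)\<close>.\<close>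

definition induced_map ::
  "'a::topological_space set \<Rightarrow> ('a \<Rightarrow> 'a) \<Rightarrow> (real \<Rightarrow> 'a) set \<Rightarrow> (real \<Rightarrow> 'a) set" where
  "induced_map M f a = (\<Union>\<gamma>\<in>a. path_class M (f \<circ> \<gamma>))"


section \<open>Free groups and Nielsen equivalence\<close>

text \<open>
  The free group on \<open>x\<^sub>0, \<dots>, x\<^sub>n\<^sub>-\<^sub>1\<close> is the group of reduced words; \<open>(i, True)\<close> stands for
  the letter \<open>x\<^sub>i\<close> and \<open>(i, False)\<close> for its inverse.
\<close>

definition cancels :: "nat \<times> bool \<Rightarrow> nat \<times> bool \<Rightarrow> bool" where
  "cancels x y \<longleftrightarrow> fst x = fst y \<and> snd x \<noteq> snd y"

fun cons_reduced :: "nat \<times> bool \<Rightarrow> (nat \<times> bool) list \<Rightarrow> (nat \<times> bool) list" where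
  "cons_reduced x [] = [x]"
| "cons_reduced x (y # w) = (if cancels x y then w else x # y # w)"

definition free_group :: "nat \<Rightarrow> (nat \<times> bool) list monoid" where
  "free_group n =
     \<lparr>carrier = {w. successively (\<lambda>x y. \<not> cancels x y) w \<and> fst ` set w \<subseteq> {..<n}},
      mult = (\<lambda>u v. foldr cons_reduced u v),
      one = []\<rparr>"

definition word_value :: "('b, 'm) monoid_scheme \<Rightarrow> 'b list \<Rightarrow> (nat \<times> bool) list \<Rightarrow> 'b" where
  "word_value G a w =
     foldr (\<lambda>(i, s) c. (if s then a ! i else inv\<^bsub>G\<^esub> (a ! i)) \<otimes>\<^bsub>G\<^esub> c) w \<one>\<^bsub>G\<^esub>"

text \<open>A basis: every element of the free group is the value of exactly one reduced word in \<open>ys\<close>.\<close>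

definition free_group_basis :: "nat \<Rightarrow> (nat \<times> bool) list list \<Rightarrow> bool" where
  "free_group_basis n ys \<longleftrightarrow>
     length ys = n \<and> set ys \<subseteq> carrier (free_group n) \<and>
     bij_betw (word_value (free_group n) ys) (carrier (free_group n)) (carrier (free_group n))"

definition generating_tuple :: "('b, 'm) monoid_scheme \<Rightarrow> 'b list \<Rightarrow> bool" where
  "generating_tuple G a \<longleftrightarrow> set a \<subseteq> carrier G \<and> generate G (set a) = carrier G"

definition nielsen_equivalent :: "('b, 'm) monoid_scheme \<Rightarrow> 'b list \<Rightarrow> 'b list \<Rightarrow> bool" where
  "nielsen_equivalent G a b \<longleftrightarrow>
     generating_tuple G a \<and> generating_tuple G b \<and> length a = length b \<and>
     (\<exists>ys \<Phi>. free_group_basis (length a) ys \<and> \<Phi> \<in> hom (free_group (length a)) G \<and>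
        (\<forall>i<length a. \<Phi> [(i, True)] = a ! i \<and> \<Phi> (ys ! i) = b ! i))"


section \<open>Spines and Nielsen classes of handlebodies\<close>

text \<open>
  A spine of \<open>H\<close> with vertex \<open>v\<close> and oriented edges \<open>cs\<close>.  The vertex is included separately in the
  graph because there are no edges when the genus is 0.
\<close>

definition spine :: "'a::topological_space set \<Rightarrow> 'a \<Rightarrow> (real \<Rightarrow> 'a) list \<Rightarrow> bool" where
  "spine H v cs \<longleftrightarrow>
     (\<forall>c\<in>set cs. simple_path c \<and> pathstart c = v \<and> pathfinish c = v) \<and>
     (\<forall>i<length cs. \<forall>j<length cs. i \<noteq> j \<longrightarrow> path_image (cs ! i) \<inter> path_image (cs ! j) = {v}) \<and>
     (\<exists>r. homotopic_with_canon (\<lambda>_. True) H H id r \<and>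
          retraction H ({v} \<union> (\<Union>c\<in>set cs. path_image c)) r)"

definition spine_tuples :: "'a::topological_space set \<Rightarrow> 'a \<Rightarrow> 'a set \<Rightarrow> (real \<Rightarrow> 'a) set list set" where
  "spine_tuples M p H =
     {map (\<lambda>c. path_class M (\<delta> +++ c +++ reversepath \<delta>)) cs | \<delta> cs v.
        spine H v cs \<and> path \<delta> \<and> path_image \<delta> \<subseteq> M \<and> pathstart \<delta> = p \<and> pathfinish \<delta> = v}"

text \<open>
  The Nielsen class of \<open>H\<close>, as a set of generating tuples of the fundamental group at \<open>p\<close>: all tuples
  Nielsen equivalent to the tuple of loops of a spine of \<open>H\<close>.  As this class does not depend on the
  spine or on the base path, the union over them is a single Nielsen class.
\<close>

definition nielsen_class :: "'a::topological_space set \<Rightarrow> 'a \<Rightarrow> 'a set \<Rightarrow> (real \<Rightarrow> 'a) set list set" where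
  "nielsen_class M p H =
     (\<Union>a\<in>spine_tuples M p H. {b. nielsen_equivalent (fundamental_group M p) a b})"

text \<open>The image of the Nielsen class of \<open>H\<close> under \<open>f\<close>, in the fundamental group at \<open>f p\<close>.\<close>

definition image_nielsen_class ::
  "'a::topological_space set \<Rightarrow> 'a \<Rightarrow> ('a \<Rightarrow> 'a) \<Rightarrow> 'a set \<Rightarrow> (real \<Rightarrow> 'a) set list set" where
  "image_nielsen_class M p f H =
     (\<Union>a\<in>spine_tuples M p H.
        {b. nielsen_equivalent (fundamental_group M (f p)) (map (induced_map M f) a) b})"

end

theory Submission
  imports Defs
begin

text \<open>
  Nielsen classes are built from spines, and spines are topological: a homeomorphism \<open>f\<close> of \<open>M\<close>
  carrying \<open>H\<close> to \<open>H'\<close> carries a retraction \<open>r\<close> of \<open>H\<close> onto a spine to the retraction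
  \<open>f \<circ> r \<circ> f\<^sup>-\<^sup>1\<close> of \<open>H'\<close> onto the image graph (\<open>spine_homeomorphic_image\<close>).
  So \<open>f\<close> matches the spines and base paths for \<open>H\<close> at \<open>p\<close> with those for \<open>H'\<close> at
  \<open>f p\<close>, and the induced map carries the tuples of the former exactly onto the tuples of the
  latter (\<open>spine_tuples_homeomorphic_image\<close>).  This settles the diffeomorphic case.

  If moreover \<open>f\<close> is the end \<open>f\<^sub>1\<close> of an isotopy \<open>f\<^sub>t\<close> starting at the identity, then a loop \<open>c\<close> based
  at \<open>v\<close> is freely homotopic to \<open>f\<^sub>1 \<circ> c\<close>, the base point moving along the track
  \<open>\<tau>(t) = f\<^sub>t(v)\<close>.  All the edges of a spine share the vertex \<open>v\<close>, so the same \<open>\<tau>\<close> serves for all of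
  them: replacing a base path \<open>\<delta>\<close> from \<open>p\<close> to \<open>v\<close> by \<open>\<delta>\<close> followed by \<open>\<tau>\<close> gives a base path for the
  image spine with literally the same tuple of homotopy classes.  Together with the reversed
  isotopy this shows that the two sets of spine tuples at \<open>p\<close> are equal
  (\<open>spine_tuples_isotopy_invariant\<close>), and hence so are the Nielsen classes.
\<close>

section \<open>Homotopy classes of paths\<close>

lemma path_class_eqI: "homotopic_paths M \<gamma> \<delta> \<Longrightarrow> path_class M \<gamma> = path_class M \<delta>"
  unfolding path_class_def by (blast intro: homotopic_paths_trans homotopic_paths_sym)

lemma induced_map_path_class:
  assumes "continuous_on M f" "f ` M \<subseteq> M" "path \<gamma>" "path_image \<gamma> \<subseteq> M"
  shows "induced_map M f (path_class M \<gamma>) = path_class M (f \<circ> \<gamma>)"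
proof -
  have "path_class M (f \<circ> \<delta>) = path_class M (f \<circ> \<gamma>)" if "\<delta> \<in> path_class M \<gamma>" for \<delta>
  proof -
    have "homotopic_paths M (f \<circ> \<gamma>) (f \<circ> \<delta>)"
      using that assms(1,2) unfolding path_class_def
      by (intro homotopic_paths_continuous_image[where S=M]) auto
    then show ?thesis
      using path_class_eqI by metis
  qed
  moreover have "\<gamma> \<in> path_class M \<gamma>"
    using assms by (simp add: path_class_def)
  ultimately show ?thesis
    unfolding induced_map_def by blast
qed

text \<open>
  In the parameter square the edge \<open>s = 0\<close> is homotopic to the path along the other three edges,
  since the square is convex, and \<open>h\<close> transports this homotopy to \<open>M\<close>.  The edges \<open>t = 0\<close> and
  \<open>t = 1\<close> both become the track of the base point, traversed in opposite directions.
\<close>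

lemma homotopic_paths_loop_along_track:
  fixes h :: "real \<Rightarrow> real \<Rightarrow> 'a::topological_space"
  assumes cont: "continuous_on ({0..1} \<times> {0..1}) (\<lambda>(s, t). h s t)"
    and sub: "\<And>s t. s \<in> {0..1} \<Longrightarrow> t \<in> {0..1} \<Longrightarrow> h s t \<in> M"
    and loop: "\<And>s. s \<in> {0..1} \<Longrightarrow> h s 1 = h s 0"
  shows "homotopic_paths M (h 0) ((\<lambda>s. h s 0) +++ h 1 +++ reversepath (\<lambda>s. h s 0))"
proof -
  let ?Q = "{0..1::real} \<times> {0..1::real}"
  let ?h = "\<lambda>(s, t). h s t"
  let ?a = "linepath (0::real, 0::real) (0, 1)"
  let ?l = "linepath (0::real, 0::real) (1, 0)"
  let ?t = "linepath (1::real, 0::real) (1, 1)"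
  let ?r = "linepath (0::real, 1::real) (1, 1)"
  have cvx: "convex ?Q"
    by (intro convex_Times) auto
  have seg: "closed_segment x y \<subseteq> ?Q" if "x \<in> ?Q" "y \<in> ?Q" for x y
    using closed_segment_subset[OF that cvx] .
  have "path_image (?l +++ ?t +++ reversepath ?r) \<subseteq> ?Q"
    by (intro subset_path_image_join) (simp_all add: seg del: mem_Times_iff)
  then have "homotopic_paths ?Q ?a (?l +++ ?t +++ reversepath ?r)"
    using convex_imp_simply_connected[OF cvx]
    unfolding simply_connected_eq_homotopic_paths
    by (auto simp: seg)
  then have "homotopic_paths M (?h \<circ> ?a) (?h \<circ> (?l +++ ?t +++ reversepath ?r))"
    by (rule homotopic_paths_continuous_image) (use cont sub in auto)
  then have *: "homotopic_paths M (?h \<circ> ?a) ((?h \<circ> ?l) +++ (?h \<circ> ?t) +++ reversepath (?h \<circ> ?r))"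
    by (simp only: path_compose_join path_compose_reversepath)
  have eqs: "?h \<circ> ?a = h 0" "?h \<circ> ?l = (\<lambda>s. h s 0)" "?h \<circ> ?t = h 1" "?h \<circ> ?r = (\<lambda>s. h s 1)"
    by (auto simp: linepath_def fun_eq_iff)
  have "homotopic_paths M (h 0) ((\<lambda>s. h s 0) +++ h 1 +++ reversepath (\<lambda>s. h s 1))"
    using * unfolding eqs .
  moreover have "homotopic_paths M ((\<lambda>s. h s 0) +++ h 1 +++ reversepath (\<lambda>s. h s 1))
                   ((\<lambda>s. h s 0) +++ h 1 +++ reversepath (\<lambda>s. h s 0))"
  proof (rule homotopic_paths_eq)
    show "path ((\<lambda>s. h s 0) +++ h 1 +++ reversepath (\<lambda>s. h s 1))"
      "path_image ((\<lambda>s. h s 0) +++ h 1 +++ reversepath (\<lambda>s. h s 1)) \<subseteq> M"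
      using homotopic_paths_imp_path homotopic_paths_imp_subset calculation by blast+
  qed (auto simp: joinpaths_def reversepath_def loop)
  ultimately show ?thesis
    by (rule homotopic_paths_trans)
qed

text \<open>
  The free homotopy \<open>h\<close> moves the base point along \<open>\<tau>\<close>; extending the base path by \<open>\<tau>\<close>
  compensates for this.
\<close>

lemma path_class_conjugate_by_track:
  fixes h :: "real \<Rightarrow> real \<Rightarrow> 'a::topological_space"
  assumes cont: "continuous_on ({0..1} \<times> {0..1}) (\<lambda>(s, t). h s t)"
    and sub: "\<And>s t. s \<in> {0..1} \<Longrightarrow> t \<in> {0..1} \<Longrightarrow> h s t \<in> M"
    and loop: "\<And>s. s \<in> {0..1} \<Longrightarrow> h s 1 = h s 0"
    and \<delta>: "path \<delta>" "path_image \<delta> \<subseteq> M" "pathfinish \<delta> = h 0 0"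
    and \<tau>: "\<tau> = (\<lambda>s. h s 0)"
  shows "path_class M (\<delta> +++ h 0 +++ reversepath \<delta>) =
         path_class M ((\<delta> +++ \<tau>) +++ h 1 +++ reversepath (\<delta> +++ \<tau>))"
proof -
  have p\<tau>: "path \<tau>" "path (h 1)"
    unfolding \<tau> path_def
    using continuous_on_compose2[OF cont, of "{0..1}" "\<lambda>s. (s, 0)"]
      continuous_on_compose2[OF cont, of "{0..1}" "\<lambda>s. (1, s)"]
    by (simp_all add: continuous_on_Pair image_subset_iff)
  have i: "path_image \<tau> \<subseteq> M" "path_image (h 1) \<subseteq> M"
    using sub by (auto simp: path_image_def \<tau>)
  have e: "pathstart \<tau> = h 0 0" "pathfinish \<tau> = h 1 0" "pathstart (h 1) = h 1 0"
    "pathfinish (h 1) = h 1 0" "pathstart (h 0) = h 0 0" "pathfinish (h 0) = h 0 0"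
    using loop by (auto simp: \<tau> pathstart_def pathfinish_def)
  note [simp] = p\<tau> i e \<delta>
  have img: "path_image (a +++ b) \<subseteq> M" if "path_image a \<subseteq> M" "path_image b \<subseteq> M" for a b
    using that by (rule subset_path_image_join)
  note [simp] = img
  have "homotopic_paths M (\<delta> +++ h 0 +++ reversepath \<delta>)
          (\<delta> +++ (\<tau> +++ h 1 +++ reversepath \<tau>) +++ reversepath \<delta>)"
    using homotopic_paths_loop_along_track[OF cont sub loop]
    by (intro homotopic_paths_join) (auto simp: \<tau>[symmetric])
  also have "homotopic_paths M \<dots> (\<delta> +++ \<tau> +++ (h 1 +++ reversepath \<tau>) +++ reversepath \<delta>)"
    by (intro homotopic_paths_join homotopic_paths_assoc[THEN homotopic_paths_sym]) auto
  also have "homotopic_paths M \<dots> ((\<delta> +++ \<tau>) +++ (h 1 +++ reversepath \<tau>) +++ reversepath \<delta>)"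
    by (intro homotopic_paths_assoc) auto
  also have "homotopic_paths M \<dots> ((\<delta> +++ \<tau>) +++ h 1 +++ reversepath \<tau> +++ reversepath \<delta>)"
    by (intro homotopic_paths_join homotopic_paths_assoc[THEN homotopic_paths_sym]) auto
  also have "reversepath \<tau> +++ reversepath \<delta> = reversepath (\<delta> +++ \<tau>)"
    by (simp add: reversepath_joinpaths)
  finally show ?thesis
    by (rule path_class_eqI)
qed


section \<open>Spines under homeomorphisms\<close>

lemma spine_subset:
  assumes "spine H v cs"
  shows "v \<in> H" "c \<in> set cs \<Longrightarrow> path_image c \<subseteq> H"
  using assms unfolding spine_def retraction_def by blast+

lemma homeomorphism_restrict:
  "homeomorphism M N f g \<Longrightarrow> H \<subseteq> M \<Longrightarrow> homeomorphism H (f ` H) f g"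
  by (rule homeomorphism_of_subsets) auto

text \<open>
  Conjugating by \<open>f\<close> the retraction onto the graph, and its homotopy to the identity, gives a
  deformation retraction onto the image graph.
\<close>

lemma spine_homeomorphic_image:
  assumes hom: "homeomorphism H H' f g" and sp: "spine H v cs"
  shows "spine H' (f v) (map ((\<circ>) f) cs)"
proof -
  let ?S = "{v} \<union> (\<Union>c\<in>set cs. path_image c)"
  obtain r where r: "homotopic_with_canon (\<lambda>_. True) H H id r" "retraction H ?S r"
    using sp unfolding spine_def by blast
  have f: "continuous_on H f" "f ` H = H'" and g: "continuous_on H' g" "g ` H' = H"
    and gf: "\<And>x. x \<in> H \<Longrightarrow> g (f x) = x" and fg: "\<And>y. y \<in> H' \<Longrightarrow> f (g y) = y"
    using hom by (auto simp: homeomorphism_def)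
  have inj: "inj_on f H"
    using gf by (rule inj_on_inverseI)
  note sub = spine_subset[OF sp]
  have edges: "simple_path (f \<circ> c)" if "c \<in> set cs" for c
    using that sp sub f(1) inj
    by (intro simple_path_continuous_image) (auto simp: spine_def intro: continuous_on_subset inj_on_subset)
  have disjoint: "path_image (f \<circ> cs ! i) \<inter> path_image (f \<circ> cs ! j) = {f v}"
    if "i < length cs" "j < length cs" "i \<noteq> j" for i j
  proof -
    have "path_image (cs ! i) \<inter> path_image (cs ! j) = {v}"
      using that sp by (auto simp: spine_def)
    then show ?thesis
      using inj_on_image_Int[OF inj sub(2)[OF nth_mem[OF that(1)]] sub(2)[OF nth_mem[OF that(2)]]]
      by (simp add: path_image_compose)
  qed
  have graph: "f ` ?S = {f v} \<union> (\<Union>c\<in>set (map ((\<circ>) f) cs). path_image c)"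
    by (auto simp: path_image_compose)
  have "homotopic_with_canon (\<lambda>_. True) H H' (f \<circ> id) (f \<circ> r)"
    by (rule homotopic_with_compose_continuous_left[OF r(1)]) (use f in auto)
  then have "homotopic_with_canon (\<lambda>_. True) H' H' (f \<circ> id \<circ> g) (f \<circ> r \<circ> g)"
    by (rule homotopic_with_compose_continuous_right) (use g in auto)
  then have "homotopic_with_canon (\<lambda>_. True) H' H' id (f \<circ> r \<circ> g)"
    by (rule homotopic_with_eq) (auto simp: fg)
  moreover have "retraction H' (f ` ?S) (f \<circ> r \<circ> g)"
    unfolding retraction_def
  proof (intro conjI ballI)
    have S: "?S \<subseteq> H" "continuous_on H r" "r ` H \<subseteq> ?S" "\<And>x. x \<in> ?S \<Longrightarrow> r x = x"
      using r(2) unfolding retraction_def by blast+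
    show "f ` ?S \<subseteq> H'"
      using S(1) f(2) by blast
    show "continuous_on H' (f \<circ> r \<circ> g)"
    proof (intro continuous_on_compose)
      show "continuous_on (r ` g ` H') f"
        using S(1,3) g(2) by (intro continuous_on_subset[OF f(1)]) blast
    qed (use S(2) g in auto)
    show "f \<circ> r \<circ> g \<in> H' \<rightarrow> f ` ?S"
      using S(3) g(2) by fastforce
    show "(f \<circ> r \<circ> g) y = y" if "y \<in> f ` ?S" for y
      using that S(1,4) gf by (metis (no_types, lifting) comp_apply imageE subsetD)
  qed
  ultimately show ?thesis
    using edges disjoint sp unfolding spine_def graph[symmetric]
    by (auto simp: pathstart_compose pathfinish_compose)
qed

lemma induced_map_conjugated_loop:
  assumes "continuous_on M f" "f ` M \<subseteq> M"
    and "path \<delta>" "path_image \<delta> \<subseteq> M" "pathfinish \<delta> = pathstart c"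
    and "path c" "path_image c \<subseteq> M" "pathfinish c = pathstart c"
  shows "induced_map M f (path_class M (\<delta> +++ c +++ reversepath \<delta>)) =
         path_class M ((f \<circ> \<delta>) +++ (f \<circ> c) +++ reversepath (f \<circ> \<delta>))"
proof -
  have "path_image (\<delta> +++ c +++ reversepath \<delta>) \<subseteq> M"
    using assms by (intro subset_path_image_join) auto
  then show ?thesis
    using assms
    by (subst induced_map_path_class) (auto simp: path_compose_join path_compose_reversepath)
qed

lemma spine_tuples_homeomorphic_image_subset:
  assumes hom: "homeomorphism M M f g" and "H \<subseteq> M"
  shows "map (induced_map M f) ` spine_tuples M p H \<subseteq> spine_tuples M (f p) (f ` H)"
proof safe
  have f: "continuous_on M f" "f ` M \<subseteq> M"
    using hom by (auto simp: homeomorphism_def)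
  fix a assume "a \<in> spine_tuples M p H"
  then obtain \<delta> cs v where a: "a = map (\<lambda>c. path_class M (\<delta> +++ c +++ reversepath \<delta>)) cs"
    and sp: "spine H v cs"
    and \<delta>: "path \<delta>" "path_image \<delta> \<subseteq> M" "pathstart \<delta> = p" "pathfinish \<delta> = v"
    unfolding spine_tuples_def by blast
  have "map (induced_map M f) a =
        map (\<lambda>c. path_class M ((f \<circ> \<delta>) +++ c +++ reversepath (f \<circ> \<delta>))) (map ((\<circ>) f) cs)"
    unfolding a list.map_comp
  proof (rule map_cong)
    fix c assume c: "c \<in> set cs"
    then have "path c" "pathstart c = v" "pathfinish c = v" "path_image c \<subseteq> M"
      using sp spine_subset(2)[OF sp c] \<open>H \<subseteq> M\<close> by (auto simp: spine_def simple_path_imp_path)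
    then show "(induced_map M f \<circ> (\<lambda>c. path_class M (\<delta> +++ c +++ reversepath \<delta>))) c =
      ((\<lambda>c. path_class M ((f \<circ> \<delta>) +++ c +++ reversepath (f \<circ> \<delta>))) \<circ> (\<circ>) f) c"
      using f \<delta> by (simp add: induced_map_conjugated_loop)
  qed simp
  moreover have "spine (f ` H) (f v) (map ((\<circ>) f) cs)"
    using spine_homeomorphic_image[OF homeomorphism_restrict[OF hom \<open>H \<subseteq> M\<close>] sp] .
  moreover have "path (f \<circ> \<delta>)" "path_image (f \<circ> \<delta>) \<subseteq> M"
    "pathstart (f \<circ> \<delta>) = f p" "pathfinish (f \<circ> \<delta>) = f v"
    using \<delta> f
    by (auto simp: path_image_compose pathstart_compose pathfinish_compose
        intro!: path_continuous_image intro: continuous_on_subset)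
  ultimately show "map (induced_map M f) a \<in> spine_tuples M (f p) (f ` H)"
    unfolding spine_tuples_def by blast
qed

lemma spine_tuple_in_group:
  assumes "H \<subseteq> M" "a \<in> spine_tuples M p H" "x \<in> set a"
  obtains \<gamma> where "x = path_class M \<gamma>" "path \<gamma>" "path_image \<gamma> \<subseteq> M"
proof -
  obtain \<delta> cs v c where x: "x = path_class M (\<delta> +++ c +++ reversepath \<delta>)"
    and sp: "spine H v cs" "c \<in> set cs"
    and \<delta>: "path \<delta>" "path_image \<delta> \<subseteq> M" "pathstart \<delta> = p" "pathfinish \<delta> = v"
    using assms(2,3) unfolding spine_tuples_def by auto
  have c: "path c" "pathstart c = v" "pathfinish c = v" "path_image c \<subseteq> M"
    using sp spine_subset(2)[OF sp] \<open>H \<subseteq> M\<close> by (auto simp: spine_def simple_path_imp_path)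
  show thesis
    by (rule that[OF x]) (use \<delta> c in \<open>simp_all add: subset_path_image_join\<close>)
qed

lemma induced_map_inverse:
  assumes hom: "homeomorphism M M f g" and \<gamma>: "path \<gamma>" "path_image \<gamma> \<subseteq> M"
  shows "induced_map M f (induced_map M g (path_class M \<gamma>)) = path_class M \<gamma>"
proof -
  have f: "continuous_on M f" "f ` M \<subseteq> M" "continuous_on M g" "g ` M \<subseteq> M"
    and fg: "\<And>x. x \<in> M \<Longrightarrow> f (g x) = x"
    using hom by (auto simp: homeomorphism_def)
  have "path (g \<circ> \<gamma>)" "path_image (g \<circ> \<gamma>) \<subseteq> M"
    using f(4) \<gamma> path_continuous_image[OF \<gamma>(1) continuous_on_subset[OF f(3) \<gamma>(2)]]
    by (auto simp: path_image_compose)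
  then have "induced_map M f (induced_map M g (path_class M \<gamma>)) = path_class M (f \<circ> (g \<circ> \<gamma>))"
    using f \<gamma> by (simp add: induced_map_path_class)
  also have "\<dots> = path_class M \<gamma>"
    using \<gamma> fg by (intro path_class_eqI[symmetric] homotopic_paths_eq)
      (auto simp: path_image_def image_subset_iff)
  finally show ?thesis .
qed

text \<open>Apply the inclusion to \<open>f\<close> and to its inverse.\<close>

lemma spine_tuples_homeomorphic_image:
  assumes hom: "homeomorphism M M f g" and "H \<subseteq> M" "p \<in> M"
  shows "spine_tuples M (f p) (f ` H) = map (induced_map M f) ` spine_tuples M p H"
proof
  show "map (induced_map M f) ` spine_tuples M p H \<subseteq> spine_tuples M (f p) (f ` H)"
    using spine_tuples_homeomorphic_image_subset assms(1,2) .
  have inv: "g (f x) = x" "f x \<in> M" if "x \<in> M" for x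
    using hom that by (auto simp: homeomorphism_def)
  then have gf: "g (f p) = p" "f ` H \<subseteq> M"
    using assms by auto
  have gfH: "g ` f ` H = H"
    unfolding image_image using inv(1) \<open>H \<subseteq> M\<close> by (simp add: subset_iff)
  show "spine_tuples M (f p) (f ` H) \<subseteq> map (induced_map M f) ` spine_tuples M p H"
  proof
    fix b assume b: "b \<in> spine_tuples M (f p) (f ` H)"
    have "map (induced_map M g) b \<in> spine_tuples M p H"
      using spine_tuples_homeomorphic_image_subset[OF homeomorphism_symD[OF hom] gf(2), of "f p"] b gf(1) gfH
      by auto
    moreover have "b = map (induced_map M f) (map (induced_map M g) b)"
      unfolding list.map_comp
    proof (rule map_idI[symmetric])
      fix x assume "x \<in> set b"
      then obtain \<gamma> where "x = path_class M \<gamma>" "path \<gamma>" "path_image \<gamma> \<subseteq> M"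
        using spine_tuple_in_group[OF gf(2) b] by blast
      then show "(induced_map M f \<circ> induced_map M g) x = x"
        using induced_map_inverse[OF hom] by simp
    qed
    ultimately show "b \<in> map (induced_map M f) ` spine_tuples M p H"
      by blast
  qed
qed


section \<open>Spines under isotopies\<close>

lemma continuous_on_family_compose:
  assumes "continuous_on (M \<times> T) (\<lambda>(x, t). F t x)"
    and "continuous_on S a" "continuous_on S b"
    and "\<And>x. x \<in> S \<Longrightarrow> a x \<in> M" "\<And>x. x \<in> S \<Longrightarrow> b x \<in> T"
  shows "continuous_on S (\<lambda>x. F (b x) (a x))"
proof -
  have "continuous_on S (\<lambda>x. (\<lambda>(x, t). F t x) (a x, b x))"
    using assms(1) by (rule continuous_on_compose2) (use assms in \<open>auto intro: continuous_on_Pair\<close>)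
  then show ?thesis
    by simp
qed

text \<open>
  A base path for a spine of \<open>H\<close> is extended by the track of the vertex; by
  \<open>path_class_conjugate_by_track\<close> the image spine then gives the same tuple.
\<close>

lemma spine_tuples_subset_of_deformation:
  fixes F :: "real \<Rightarrow> 'a::topological_space \<Rightarrow> 'a"
  assumes cont: "continuous_on (M \<times> {0..1}) (\<lambda>(x, t). F t x)"
    and maps: "\<And>t x. t \<in> {0..1} \<Longrightarrow> x \<in> M \<Longrightarrow> F t x \<in> M"
    and start: "\<And>x. x \<in> M \<Longrightarrow> F 0 x = x"
    and hom: "homeomorphism H H' (F 1) g" and "H \<subseteq> M"
  shows "spine_tuples M p H \<subseteq> spine_tuples M p H'"
proof
  fix a assume "a \<in> spine_tuples M p H"
  then obtain \<delta> cs v where a: "a = map (\<lambda>c. path_class M (\<delta> +++ c +++ reversepath \<delta>)) cs"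
    and sp: "spine H v cs"
    and \<delta>: "path \<delta>" "path_image \<delta> \<subseteq> M" "pathstart \<delta> = p" "pathfinish \<delta> = v"
    unfolding spine_tuples_def by blast
  define \<tau> where "\<tau> = (\<lambda>t. F t v)"
  have v: "v \<in> M"
    using spine_subset(1)[OF sp] \<open>H \<subseteq> M\<close> by blast
  have "path \<tau>"
    unfolding path_def \<tau>_def
    by (rule continuous_on_family_compose[OF cont]) (use v in auto)
  moreover have "path_image \<tau> \<subseteq> M" "pathstart \<tau> = v" "pathfinish \<tau> = F 1 v"
    using maps v start by (auto simp: path_image_def \<tau>_def pathstart_def pathfinish_def)
  ultimately have \<delta>\<tau>: "path (\<delta> +++ \<tau>)" "path_image (\<delta> +++ \<tau>) \<subseteq> M"
    "pathstart (\<delta> +++ \<tau>) = p" "pathfinish (\<delta> +++ \<tau>) = F 1 v"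
    using \<delta> by (simp_all add: subset_path_image_join)
  have "a = map (\<lambda>c. path_class M ((\<delta> +++ \<tau>) +++ c +++ reversepath (\<delta> +++ \<tau>))) (map ((\<circ>) (F 1)) cs)"
    unfolding a list.map_comp
  proof (rule map_cong)
    fix c assume c: "c \<in> set cs"
    have pc: "path c" and ends: "pathstart c = v" "pathfinish c = v" and ic: "path_image c \<subseteq> M"
      using c sp spine_subset(2)[OF sp c] \<open>H \<subseteq> M\<close> by (auto simp: spine_def simple_path_imp_path)
    have cM: "c t \<in> M" if "t \<in> {0..1}" for t
      using ic that by (auto simp: path_image_def)
    have "continuous_on ({0..1} \<times> {0..1}) (\<lambda>x. c (snd x))"
      using pc unfolding path_def
      by (rule continuous_on_compose2) (auto intro!: continuous_intros)
    then have cont_h: "continuous_on ({0..1} \<times> {0..1}) (\<lambda>(s, t). F s (c t))"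
      unfolding case_prod_unfold
      by (rule continuous_on_family_compose[OF cont]) (use cM in \<open>auto intro!: continuous_intros\<close>)
    have "path_class M (\<delta> +++ (\<lambda>t. F 0 (c t)) +++ reversepath \<delta>) =
          path_class M ((\<delta> +++ \<tau>) +++ (\<lambda>t. F 1 (c t)) +++ reversepath (\<delta> +++ \<tau>))"
      using ends \<delta> v start cM maps
      by (intro path_class_conjugate_by_track[OF cont_h])
        (auto simp: \<tau>_def pathstart_def pathfinish_def)
    moreover have "homotopic_paths M c (\<lambda>t. F 0 (c t))"
      using pc ic by (rule homotopic_paths_eq) (use cM start in auto)
    then have "path_class M (\<delta> +++ c +++ reversepath \<delta>) =
          path_class M (\<delta> +++ (\<lambda>t. F 0 (c t)) +++ reversepath \<delta>)"
      by (intro path_class_eqI homotopic_paths_join) (use \<delta> ends in simp_all)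
    ultimately show "path_class M (\<delta> +++ c +++ reversepath \<delta>) =
        ((\<lambda>c. path_class M ((\<delta> +++ \<tau>) +++ c +++ reversepath (\<delta> +++ \<tau>))) \<circ> (\<circ>) (F 1)) c"
      by (simp add: comp_def)
  qed simp
  then show "a \<in> spine_tuples M p H'"
    using spine_homeomorphic_image[OF hom sp] \<delta>\<tau> unfolding spine_tuples_def by blast
qed

lemma spine_tuples_isotopy_invariant:
  fixes F :: "real \<Rightarrow> 'a::topological_space \<Rightarrow> 'a"
  assumes cont: "continuous_on (M \<times> {0..1}) (\<lambda>(x, t). F t x)"
    and maps: "\<And>t x. t \<in> {0..1} \<Longrightarrow> x \<in> M \<Longrightarrow> F t x \<in> M"
    and start: "\<And>x. x \<in> M \<Longrightarrow> F 0 x = x"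
    and hom: "homeomorphism M M (F 1) g" and "H \<subseteq> M"
  shows "spine_tuples M p H = spine_tuples M p (F 1 ` H)"
proof
  note homH = homeomorphism_restrict[OF hom \<open>H \<subseteq> M\<close>]
  show "spine_tuples M p H \<subseteq> spine_tuples M p (F 1 ` H)"
    using spine_tuples_subset_of_deformation[OF cont maps start homH \<open>H \<subseteq> M\<close>] .
  have g: "continuous_on M g" "\<And>x. x \<in> M \<Longrightarrow> g x \<in> M" "\<And>x. x \<in> M \<Longrightarrow> F 1 (g x) = x"
    using hom by (auto simp: homeomorphism_def)
  \<comment> \<open>The isotopy run backwards, precomposed with \<open>g\<close> so that it starts at the identity.\<close>
  let ?G = "\<lambda>t x. F (1 - t) (g x)"
  have "continuous_on (M \<times> {0..1::real}) (\<lambda>x. g (fst x))"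
    using g(1) by (rule continuous_on_compose2) (auto intro!: continuous_intros)
  then have "continuous_on (M \<times> {0..1}) (\<lambda>(x, t). ?G t x)"
    unfolding case_prod_unfold
    by (rule continuous_on_family_compose[OF cont]) (use g(2) in \<open>auto intro!: continuous_intros\<close>)
  moreover have "homeomorphism (F 1 ` H) H (?G 1) (F 1)"
    by (rule homeomorphism_cong[OF homeomorphism_symD[OF homH]])
      (use start g(2) hom \<open>H \<subseteq> M\<close> in \<open>auto simp: homeomorphism_def\<close>)
  moreover have "F 1 ` H \<subseteq> M"
    using maps \<open>H \<subseteq> M\<close> by auto
  ultimately show "spine_tuples M p (F 1 ` H) \<subseteq> spine_tuples M p H"
    by (intro spine_tuples_subset_of_deformation[of M ?G]) (use g maps in auto)
qed


section \<open>Nielsen classes of trisections\<close>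

lemma diffeomorphism_imp_homeomorphism:
  "diffeomorphism A X B Y f \<Longrightarrow> homeomorphism X Y f (inv_into X f)"
  unfolding diffeomorphism_def smooth_map_def
  by (intro homeomorphismI)
    (auto simp: bij_betw_def f_inv_into_f inv_into_into)

theorem proposition4p5:
  fixes M :: "'a::topological_space set"
    and A :: "('a, real ^ 4) atlas"
    and X X' :: "nat \<Rightarrow> 'a set"
    and g k :: nat
  assumes "closed_smooth_manifold M A"
    and "orientable_atlas M A"
    and "trisection M A g k X"
    and "trisection M A g k X'"
  shows "(isotopic_trisections M A X X' \<longrightarrow>
            (\<forall>i\<in>{1, 2, 3}. \<forall>p\<in>M. nielsen_class M p (X i) = nielsen_class M p (X' i))) \<and>
         (\<forall>f. diffeomorphic_trisections M A X X' f \<longrightarrow>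
            (\<forall>i\<in>{1, 2, 3}. \<forall>p\<in>M. image_nielsen_class M p f (X i) = nielsen_class M (f p) (X' i)))"
proof -
  have XM: "X i \<subseteq> M" if "i \<in> {1, 2, 3}" for i
    using assms(3) that unfolding trisection_def by auto
  have "nielsen_class M p (X i) = nielsen_class M p (X' i)"
    if iso: "isotopic_trisections M A X X'" and i: "i \<in> {1, 2, 3}" for i p
  proof -
    obtain F where F: "smooth_isotopy M A F" "\<And>x. x \<in> M \<Longrightarrow> F 0 x = x"
      and im: "\<forall>i\<in>{1, 2, 3}. F 1 ` X i = X' i"
      using iso unfolding isotopic_trisections_def by blast
    have diffeo: "diffeomorphism A M A M (F t)" if "t \<in> {0..1}" for t
      using F(1) that unfolding smooth_isotopy_def by blast
    have "spine_tuples M p (X i) = spine_tuples M p (F 1 ` X i)"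
    proof (rule spine_tuples_isotopy_invariant)
      show "continuous_on (M \<times> {0..1}) (\<lambda>(x, t). F t x)"
        using F(1) unfolding smooth_isotopy_def smooth_map_def by blast
      show "F t x \<in> M" if "t \<in> {0..1}" "x \<in> M" for t x
        using diffeo[OF that(1)] that(2) unfolding diffeomorphism_def by (blast dest: bij_betwE)
      show "homeomorphism M M (F 1) (inv_into M (F 1))"
        using diffeomorphism_imp_homeomorphism[OF diffeo] by simp
    qed (use F(2) XM[OF i] in auto)
    also have "F 1 ` X i = X' i"
      using im i by (rule bspec)
    finally show ?thesis
      unfolding nielsen_class_def by simp
  qed
  moreover have "image_nielsen_class M p f (X i) = nielsen_class M (f p) (X' i)"
    if "diffeomorphic_trisections M A X X' f" and i: "i \<in> {1, 2, 3}" and "p \<in> M" for f i p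
  proof -
    have "homeomorphism M M f (inv_into M f)" and im: "f ` X i = X' i"
      using that unfolding diffeomorphic_trisections_def
      by (blast intro: diffeomorphism_imp_homeomorphism)+
    from spine_tuples_homeomorphic_image[OF this(1) XM[OF i] \<open>p \<in> M\<close>] show ?thesis
      unfolding image_nielsen_class_def nielsen_class_def im by simp
  qed
  ultimately show ?thesis
    by blast
qed

end
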